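(* For $j\in\{0,1\}$ and all positive integers $n$ and $r$, the expression $$\frac{1}{[n]^2}{2n\brack n}^{-1}\sum_{k=1}^{n}[2k][k]^{2r}q^{(r+1)(n-k)+jk^2}{2n\brack n+k}$$ is a polynomial in $q$ with integer coefficients.
   Context: Here $q$ is an indeterminate. For a non-negative integer $n$, the $q$-integer is $[n]=\frac{1-q^n}{1-q}=1+q+\cdots+q^{n-1}$. The $q$-shifted factorials are $(a;q)_0=1$ and $(a;q)_n=(1-a)(1-aq)\cdots(1-aq^{n-1})$ for $n\geq 1$. The $q$-binomial coefficients are ${n\brack k}=\frac{(q;q)_n}{(q;q)_k(q;q)_{n-k}}$ if $0\leq k\leq n$, and ${n\brack k}=0$ otherwise. The expression is a priori an element of the field $\mathbb{Q}(q)$. *)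

theory Defs
  imports "HOL-Computational_Algebra.Computational_Algebra"
begin

definition q_int :: "'a::field \<Rightarrow> nat \<Rightarrow> 'a" where
  "q_int q n = (1 - q ^ n) / (1 - q)"

definition q_shifted_fact :: "'a::field \<Rightarrow> 'a \<Rightarrow> nat \<Rightarrow> 'a" where
  "q_shifted_fact a q n = (\<Prod>i<n. 1 - a * q ^ i)"

definition q_binom :: "'a::field \<Rightarrow> nat \<Rightarrow> nat \<Rightarrow> 'a" where
  "q_binom q n k =
     (if k \<le> n then q_shifted_fact q q n / (q_shifted_fact q q k * q_shifted_fact q q (n - k))
      else 0)"

text \<open>The indeterminate \<open>q\<close>, as an element of the field of rational functions over the rationals.\<close>

definition q_var :: "rat poly fract" where
  "q_var = to_fract [:0, 1:]"

end

theory Submission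
  imports Defs
begin

text \<open>
  Write \<open>S r n\<close> for the sum and \<open>B n\<close> for the central \<open>q\<close>-binomial coefficient; the claim is that
  \<open>S r n / ([n]\<^sup>2 B n)\<close> is an integer polynomial. The whole proof is a recurrence in \<open>r\<close>.
  The identity \<open>q^(n-k) [k]\<^sup>2 = [n]\<^sup>2 - [n-k][n+k]\<close> turns the additional factor that distinguishes
  a summand of \<open>S (r+1) n\<close> from one of \<open>S r n\<close> into two parts. The first part is independent of \<open>k\<close>,
  and in the second part \<open>[n-k][n+k]\<close> is absorbed by the \<open>q\<close>-binomial coefficient, which lowers
  \<open>n\<close> by one at the cost of the factor \<open>[2n][2n-1]\<close>. Since \<open>[2n][2n-1] B (n-1) = [n]\<^sup>2 B n\<close>,
  the quotients \<open>U r n = S r n / B n\<close> satisfy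
  \<open>U (r+1) n = [n]\<^sup>2 (U r n - q^(r+1) U r (n-1))\<close>
  (lemma \<open>q_moment_Suc\<close>, turned into quotients in \<open>q_moment_eq\<close>). So each step from \<open>r\<close> to \<open>r+1\<close>
  itself creates the factor \<open>[n]\<^sup>2\<close>, and only the integrality of \<open>U 0 n\<close> is left.
  There the two values of \<open>j\<close> enter: for both of them the sum for \<open>r = 0\<close> telescopes,
  to \<open>U 0 n = q^(j n) [n]\<close> (lemma \<open>q_moment_0\<close>).
\<close>

section \<open>Moments and their quotients\<close>

definition q_moment :: "'a::field \<Rightarrow> nat \<Rightarrow> nat \<Rightarrow> nat \<Rightarrow> 'a" where
  "q_moment q j r n = (\<Sum>k = 1..n. q_int q (2 * k) * q_int q k ^ (2 * r) *
     q ^ ((r + 1) * (n - k) + j * k\<^sup>2) * q_binom q (2 * n) (n + k))"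

text \<open>
  The quotient of \<open>q_moment q j r n\<close> by the central \<open>q\<close>-binomial coefficient, defined by the
  recurrence instead of the division, so that integrality is visible from the equations.
  At \<open>n = 0\<close> both equations give \<open>0\<close> because of the factor \<open>[0]\<close>, whatever \<open>n - 1\<close> means there.
\<close>

fun q_moment_quot :: "'a::field \<Rightarrow> nat \<Rightarrow> nat \<Rightarrow> nat \<Rightarrow> 'a" where
  "q_moment_quot q j 0 n = q ^ (j * n) * q_int q n"
| "q_moment_quot q j (Suc r) n =
     (q_int q n)\<^sup>2 * (q_moment_quot q j r n - q ^ Suc r * q_moment_quot q j r (n - 1))"

section \<open>Absorption identities for q-binomial coefficients\<close>

lemma q_int_add: "q_int q (m + n) = q_int q m + q ^ m * q_int q n"
  by (simp add: q_int_def power_add right_diff_distrib flip: add_divide_distrib)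

context
  fixes q :: "'a::field"
  assumes not_root_of_unity: "\<And>m. m > 0 \<Longrightarrow> q ^ m \<noteq> 1"
begin

lemma one_minus_power_neq_0: "m > 0 \<Longrightarrow> 1 - q ^ m \<noteq> 0"
  using not_root_of_unity by simp

lemma one_minus_neq_0: "1 - q \<noteq> 0"
  using one_minus_power_neq_0[of 1] by simp

lemma q_int_neq_0: "m > 0 \<Longrightarrow> q_int q m \<noteq> 0"
  using one_minus_power_neq_0 one_minus_neq_0 by (simp add: q_int_def)

lemma q_shifted_fact_Suc:
  "q_shifted_fact q q (Suc n) = q_shifted_fact q q n * (1 - q ^ Suc n)"
  by (simp add: q_shifted_fact_def)

lemma q_shifted_fact_neq_0: "q_shifted_fact q q n \<noteq> 0"
proof (induction n)
  case 0
  show ?case by (simp add: q_shifted_fact_def)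
next
  case (Suc n)
  then show ?case
    using one_minus_power_neq_0[of "Suc n"] by (simp only: q_shifted_fact_Suc) simp
qed

lemma q_binom_neq_0: "k \<le> n \<Longrightarrow> q_binom q n k \<noteq> 0"
  by (simp add: q_binom_def q_shifted_fact_neq_0)

lemma q_binom_absorb:
  "q_int q (Suc k) * q_binom q (k + m) (Suc k) = q_int q m * q_binom q (k + m) k"
proof (cases m)
  case 0
  then show ?thesis by (simp add: q_binom_def q_int_def)
next
  case (Suc b)
  define x y where "x = 1 - q ^ Suc k" and "y = 1 - q ^ Suc b"
  have "x \<noteq> 0" "y \<noteq> 0"
    unfolding x_def y_def using one_minus_power_neq_0 by blast+
  then show ?thesis
    unfolding Suc q_int_def q_binom_def
    by (simp add: q_shifted_fact_Suc flip: x_def y_def del: power_Suc)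
qed

text \<open>
  The product \<open>[a+1][b+1]\<close> removes one factor from each of the two \<open>q\<close>-factorials in the denominator.
  With \<open>a = n - 1 + k\<close> and \<open>b = n - 1 - k\<close> this lowers \<open>n\<close> in a summand, and with
  \<open>a = b = n - 1\<close> it relates consecutive central coefficients, with the same factor \<open>[2n][2n-1]\<close>.
\<close>

lemma q_binom_absorb_both:
  "q_int q (Suc a) * q_int q (Suc b) * q_binom q (Suc (Suc (a + b))) (Suc a) =
   q_int q (Suc (Suc (a + b))) * q_int q (Suc (a + b)) * q_binom q (a + b) a"
proof -
  define x y z w where "x = 1 - q ^ Suc a" and "y = 1 - q ^ Suc b"
    and "z = 1 - q ^ Suc (a + b)" and "w = 1 - q ^ Suc (Suc (a + b))"
  have "x \<noteq> 0" "y \<noteq> 0"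
    unfolding x_def y_def using one_minus_power_neq_0 by blast+
  moreover have "Suc (Suc (a + b)) - Suc a = Suc b" by simp
  ultimately show ?thesis
    unfolding q_int_def q_binom_def
    by (simp add: q_shifted_fact_Suc mult_ac flip: x_def y_def z_def w_def del: power_Suc)
qed

section \<open>The recurrence for the moments\<close>

text \<open>
  Symmetrically, \<open>q^(-k) [k]\<^sup>2\<close> and \<open>q^(-n) [n]\<^sup>2\<close> differ by a product of two \<open>q\<close>-integers because
  \<open>q^n + q^(-n) - q^k - q^(-k)\<close> factors. This is the \<open>q\<close>-analogue of a difference of squares.
\<close>

lemma q_int_square_diff:
  "q ^ d * (q_int q k)\<^sup>2 = (q_int q (k + d))\<^sup>2 - q_int q d * q_int q (2 * k + d)"
proof -
  have "q ^ d * (1 - q ^ k)\<^sup>2 = (1 - q ^ (k + d))\<^sup>2 - (1 - q ^ d) * (1 - q ^ (2 * k + d))"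
    unfolding power_add mult_2 by algebra
  then show ?thesis
    unfolding q_int_def by (simp add: power_divide flip: power2_eq_square diff_divide_distrib)
qed

lemma q_moment_Suc:
  "q_moment q j (Suc r) (Suc m) =
     (q_int q (Suc m))\<^sup>2 * q_moment q j r (Suc m) -
     q ^ Suc r * (q_int q (2 * Suc m) * q_int q (2 * m + 1)) * q_moment q j r m"
proof -
  define n where "n = Suc m"
  define c where "c k = q_int q (2 * k) * q_int q k ^ (2 * r)" for k
  define t where "t k = c k * q ^ ((r + 1) * (n - k) + j * k\<^sup>2)" for k
  have split: "q_int q (2 * k) * q_int q k ^ (2 * Suc r) *
        q ^ ((Suc r + 1) * (n - k) + j * k\<^sup>2) * q_binom q (2 * n) (n + k) =
      (q_int q n)\<^sup>2 * (t k * q_binom q (2 * n) (n + k)) -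
      t k * (q_int q (n - k) * q_int q (n + k) * q_binom q (2 * n) (n + k))"
    if "k \<in> {1..n}" for k
  proof -
    have sq: "q ^ (n - k) * (q_int q k)\<^sup>2 = (q_int q n)\<^sup>2 - q_int q (n - k) * q_int q (n + k)"
      using q_int_square_diff[of "n - k" k] that by (simp add: mult_2 add.commute)
    have "q_int q (2 * k) * q_int q k ^ (2 * Suc r) *
        q ^ ((Suc r + 1) * (n - k) + j * k\<^sup>2) * q_binom q (2 * n) (n + k) =
        t k * (q ^ (n - k) * (q_int q k)\<^sup>2) * q_binom q (2 * n) (n + k)"
      by (simp add: t_def c_def power_add power2_eq_square algebra_simps)
    then show ?thesis unfolding sq by (simp add: algebra_simps)
  qed
  have lower: "t k * (q_int q (n - k) * q_int q (n + k) * q_binom q (2 * n) (n + k)) =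
      q ^ Suc r * (q_int q (2 * n) * q_int q (2 * m + 1)) *
      (c k * q ^ ((r + 1) * (m - k) + j * k\<^sup>2) * q_binom q (2 * m) (m + k))"
    if "k \<in> {1..m}" for k
  proof -
    have eqs: "n - k = Suc (m - k)" "n + k = Suc (m + k)" "(m + k) + (m - k) = 2 * m"
      "2 * n = Suc (Suc (2 * m))"
      using that by (auto simp: n_def)
    have "q_int q (n - k) * q_int q (n + k) * q_binom q (2 * n) (n + k) =
        q_int q (2 * n) * q_int q (2 * m + 1) * q_binom q (2 * m) (m + k)"
      using q_binom_absorb_both[of "m + k" "m - k"] unfolding eqs by (simp add: mult_ac)
    moreover have "t k = q ^ Suc r * (c k * q ^ ((r + 1) * (m - k) + j * k\<^sup>2))"
      unfolding t_def eqs(1) by (simp add: power_add algebra_simps)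
    ultimately show ?thesis by (simp only: mult_ac)
  qed
  have "(\<Sum>k = 1..n. t k * (q_int q (n - k) * q_int q (n + k) * q_binom q (2 * n) (n + k))) =
      (\<Sum>k = 1..m. t k * (q_int q (n - k) * q_int q (n + k) * q_binom q (2 * n) (n + k)))"
    \<comment> \<open>The summand for \<open>k = n\<close> contains \<open>[0]\<close>.\<close>
    by (simp add: n_def q_int_def)
  also have "\<dots> = q ^ Suc r * (q_int q (2 * n) * q_int q (2 * m + 1)) * q_moment q j r m"
    unfolding q_moment_def sum_distrib_left
    by (rule sum.cong) (simp_all only: lower c_def)
  finally have "(\<Sum>k = 1..n. t k * (q_int q (n - k) * q_int q (n + k) * q_binom q (2 * n) (n + k))) =
      q ^ Suc r * (q_int q (2 * n) * q_int q (2 * m + 1)) * q_moment q j r m" .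
  moreover have "q_moment q j r n = (\<Sum>k = 1..n. t k * q_binom q (2 * n) (n + k))"
    by (simp add: q_moment_def t_def c_def)
  moreover have "q_moment q j (Suc r) n =
      (q_int q n)\<^sup>2 * (\<Sum>k = 1..n. t k * q_binom q (2 * n) (n + k)) -
      (\<Sum>k = 1..n. t k * (q_int q (n - k) * q_int q (n + k) * q_binom q (2 * n) (n + k)))"
    unfolding q_moment_def sum_distrib_left sum_subtractf[symmetric]
    by (rule sum.cong) (simp_all only: split)
  ultimately show ?thesis unfolding n_def by simp
qed

section \<open>The telescoping base case\<close>

text \<open>
  For \<open>r = 0\<close> the summand is \<open>F k - F (k + 1)\<close> with
  \<open>F k = q^(j (n + k^2 - k)) [n + k] C(n + k)\<close>, where \<open>C(i)\<close> is the \<open>q\<close>-binomial coefficient of \<open>2n\<close>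
  over \<open>i\<close>. Indeed \<open>[n+k+1] C(n+k+1) = [n-k] C(n+k)\<close>, so the claim reduces to
  \<open>[n+k] - [n-k] = q^(n-k) [2k]\<close> for \<open>j = 0\<close> and to \<open>[n+k] - q^(2k) [n-k] = [2k]\<close> for \<open>j = 1\<close>.
\<close>

lemma q_moment_0:
  assumes "j \<in> {0, 1}"
  shows "q_moment q j 0 n = q ^ (j * n) * q_int q n * q_binom q (2 * n) n"
proof -
  define F where "F k = q ^ (j * (n + k * (k - 1))) * q_int q (n + k) * q_binom q (2 * n) (n + k)"
    for k
  have step: "q_int q (2 * k) * q_int q k ^ (2 * 0) *
      q ^ ((0 + 1) * (n - k) + j * k\<^sup>2) * q_binom q (2 * n) (n + k) = F k - F (Suc k)"
    if "k \<in> {1..n}" for k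
  proof -
    obtain d where d: "n = k + d"
      by (rule that[of "n - k"]) (use \<open>k \<in> {1..n}\<close> in simp)
    obtain l where l: "k = Suc l"
      by (cases k) (use \<open>k \<in> {1..n}\<close> in auto)
    have sums: "n + k + d = 2 * n" "n + k = d + 2 * k" "n - k = d"
      using d by simp_all
    have "q_int q (n + Suc k) * q_binom q (2 * n) (n + Suc k) =
        q_int q d * q_binom q (2 * n) (n + k)"
      using q_binom_absorb[of "n + k" d] unfolding sums(1) by simp
    then have "F (Suc k) = q ^ (j * (n + Suc k * k)) * q_int q d * q_binom q (2 * n) (n + k)"
      unfolding F_def by (simp only: diff_Suc_1 mult.assoc)
    then have diff: "F k - F (Suc k) =
        (q ^ (j * (n + k * (k - 1))) * q_int q (n + k) - q ^ (j * (n + Suc k * k)) * q_int q d) *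
        q_binom q (2 * n) (n + k)"
      unfolding F_def[of k] by (simp only: left_diff_distrib)
    have coeff: "q ^ (j * (n + k * (k - 1))) * q_int q (n + k) -
        q ^ (j * (n + Suc k * k)) * q_int q d = q ^ (d + j * k\<^sup>2) * q_int q (2 * k)"
    proof (cases "j = 0")
      case True
      then show ?thesis unfolding sums(2) q_int_add[of q d] by simp
    next
      case False
      then have j: "j = 1" using assms by simp
      have exps: "n + k * (k - 1) = d + k\<^sup>2" "n + Suc k * k = d + k\<^sup>2 + 2 * k"
        by (simp_all add: d l power2_eq_square)
      have "q_int q (n + k) = q_int q (2 * k) + q ^ (2 * k) * q_int q d"
        unfolding sums(2) add.commute[of d] by (rule q_int_add)
      then show ?thesis
        unfolding exps j mult_1 power_add[of q "d + k\<^sup>2" "2 * k"]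
        by (simp add: distrib_left mult.assoc)
    qed
    show ?thesis unfolding diff coeff sums(3) by (simp add: mult_ac)
  qed
  have "q_moment q j 0 n = (\<Sum>k = 1..n. F k - F (Suc k))"
    unfolding q_moment_def by (rule sum.cong) (simp_all only: step)
  also have "\<dots> = F 1 - F (Suc n)"
    using sum_Suc_diff[of 1 n "\<lambda>k. - F k"] by simp
  also have "F (Suc n) = 0"
    by (simp add: F_def q_binom_def)
  also have "F 1 = q ^ (j * n) * q_int q n * q_binom q (2 * n) n"
    using q_binom_absorb[of n n] by (simp add: F_def mult_2 mult.assoc)
  finally show ?thesis by simp
qed

section \<open>Division by the central coefficient\<close>

lemma q_moment_eq:
  assumes "j \<in> {0, 1}"
  shows "q_moment q j r n = q_moment_quot q j r n * q_binom q (2 * n) n"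
proof (induction r arbitrary: n)
  case 0
  show ?case using q_moment_0[OF assms] by simp
next
  case (Suc r)
  show ?case
  proof (cases n)
    case 0
    then show ?thesis by (simp add: q_moment_def q_int_def)
  next
    case n: (Suc m)
    have central: "q_int q (2 * Suc m) * q_int q (2 * m + 1) * q_binom q (2 * m) m =
        (q_int q (Suc m))\<^sup>2 * q_binom q (2 * Suc m) (Suc m)"
      using q_binom_absorb_both[of m m] by (simp add: power2_eq_square mult_2)
    have "q_moment q j (Suc r) n =
        (q_int q (Suc m))\<^sup>2 * (q_moment_quot q j r (Suc m) * q_binom q (2 * Suc m) (Suc m)) -
        q ^ Suc r * q_moment_quot q j r m *
          (q_int q (2 * Suc m) * q_int q (2 * m + 1) * q_binom q (2 * m) m)"
      unfolding n q_moment_Suc Suc.IH by (simp only: mult_ac)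
    also have "\<dots> = q_moment_quot q j (Suc r) n * q_binom q (2 * n) n"
      unfolding central n by (simp add: algebra_simps)
    finally show ?thesis .
  qed
qed

end

section \<open>Integer polynomials inside the rational functions\<close>

definition int_polys :: "rat poly fract set" where
  "int_polys = range (\<lambda>p :: int poly. to_fract (map_poly rat_of_int p))"

lemma map_poly_rat_of_int_diff:
  "map_poly rat_of_int (p - p') = map_poly rat_of_int p - map_poly rat_of_int p'"
  by (rule poly_eqI) (simp add: coeff_map_poly)

lemma map_poly_rat_of_int_add:
  "map_poly rat_of_int (p + p') = map_poly rat_of_int p + map_poly rat_of_int p'"
  by (rule poly_eqI) (simp add: coeff_map_poly)

lemma map_poly_rat_of_int_mult:
  "map_poly rat_of_int (p * p') = map_poly rat_of_int p * map_poly rat_of_int p'"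
  by (rule poly_eqI) (simp add: coeff_map_poly coeff_mult)

lemma int_polys_1: "1 \<in> int_polys"
  unfolding int_polys_def by (rule range_eqI[of _ _ 1]) simp

lemma int_polys_0: "0 \<in> int_polys"
  unfolding int_polys_def by (rule range_eqI[of _ _ 0]) simp

lemma q_var_in_int_polys: "q_var \<in> int_polys"
  unfolding int_polys_def q_var_def by (rule range_eqI[of _ _ "[:0, 1:]"]) (simp add: map_poly_pCons)

lemma int_polys_add: "x \<in> int_polys \<Longrightarrow> y \<in> int_polys \<Longrightarrow> x + y \<in> int_polys"
  unfolding int_polys_def
  by (auto simp flip: map_poly_rat_of_int_add to_fract_add)

lemma int_polys_diff: "x \<in> int_polys \<Longrightarrow> y \<in> int_polys \<Longrightarrow> x - y \<in> int_polys"
  unfolding int_polys_def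
  by (auto simp flip: map_poly_rat_of_int_diff to_fract_diff)

lemma int_polys_mult: "x \<in> int_polys \<Longrightarrow> y \<in> int_polys \<Longrightarrow> x * y \<in> int_polys"
  unfolding int_polys_def
  by (auto simp flip: map_poly_rat_of_int_mult to_fract_mult)

lemma int_polys_power: "x \<in> int_polys \<Longrightarrow> x ^ n \<in> int_polys"
  by (induction n) (simp_all add: int_polys_1 int_polys_mult)

lemma q_var_power_neq_1:
  assumes "m > 0"
  shows "q_var ^ m \<noteq> 1"
proof
  assume "q_var ^ m = 1"
  moreover have "q_var ^ m = to_fract (monom 1 m)"
    by (induction m) (simp_all add: q_var_def monom_Suc flip: to_fract_mult)
  ultimately have "to_fract (monom 1 m) = to_fract (1 :: rat poly)"
    by simp
  then have "degree (monom (1 :: rat) m) = degree (1 :: rat poly)"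
    by (simp only: to_fract_eq_iff)
  then show False using assms by (simp add: degree_monom_eq)
qed

lemma q_int_in_int_polys: "q_int q_var n \<in> int_polys"
proof (induction n)
  case 0
  show ?case by (simp add: q_int_def int_polys_0)
next
  case (Suc n)
  have "q_int q_var 1 = 1"
    using q_var_power_neq_1[of 1] by (simp add: q_int_def)
  then have "q_int q_var (Suc n) = q_int q_var n + q_var ^ n"
    using q_int_add[of q_var n 1] by simp
  then show ?case
    using Suc by (simp add: int_polys_add int_polys_power q_var_in_int_polys)
qed

lemma q_moment_quot_in_int_polys: "q_moment_quot q_var j r n \<in> int_polys"
  by (induction r arbitrary: n)
    (simp_all add: int_polys_mult int_polys_diff int_polys_power q_var_in_int_polys
      q_int_in_int_polys del: power_Suc)

theorem theorem1p1:
  fixes j n r :: nat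
  assumes "j \<in> {0, 1}" and "n > 0" and "r > 0"
  shows "\<exists>p :: int poly.
    1 / (q_int q_var n)\<^sup>2 * inverse (q_binom q_var (2 * n) n) *
      (\<Sum>k = 1..n. q_int q_var (2 * k) * q_int q_var k ^ (2 * r) *
         q_var ^ ((r + 1) * (n - k) + j * k\<^sup>2) * q_binom q_var (2 * n) (n + k))
    = to_fract (map_poly rat_of_int p)"
proof -
  obtain s where r: "r = Suc s"
    using assms(3) by (cases r) auto
  define u where "u = q_moment_quot q_var j s n - q_var ^ Suc s * q_moment_quot q_var j s (n - 1)"
  have "u \<in> int_polys"
    unfolding u_def
    by (intro int_polys_diff int_polys_mult int_polys_power q_moment_quot_in_int_polys
        q_var_in_int_polys)
  moreover have "q_moment q_var j r n = (q_int q_var n)\<^sup>2 * u * q_binom q_var (2 * n) n"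
    using q_moment_eq[OF q_var_power_neq_1 assms(1), of r n] by (simp add: r u_def)
  then have "1 / (q_int q_var n)\<^sup>2 * inverse (q_binom q_var (2 * n) n) * q_moment q_var j r n = u"
    using q_int_neq_0[OF q_var_power_neq_1 assms(2)]
      q_binom_neq_0[OF q_var_power_neq_1, of n "2 * n"]
    by (simp add: field_simps)
  ultimately show ?thesis
    unfolding int_polys_def q_moment_def by auto
qed

end
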